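(* Let $G=(V,A)$ be a connected bi-directed graph with $n=|V|$ and $m=|A|$, let $r\in V$ be any root, and let $0<p_a<1$ for each $a\in A$, with $p_{\max}=\max_{a\in A}p_a$. Then the expected number of random variables drawn by the cluster-popping algorithm on $G$ (including the initial draws) is at most $m+\frac{p_{\max}mn}{1-p_{\max}}$.
   Context: A bi-directed graph is a directed graph in which every arc $u\to v$ has its reversal $v\to u$ also present. For $S\subseteq A$, a cluster of $(V,S)$ is a set $C\subseteq V\setminus\{r\}$ with no arc of $S$ leaving $C$; a minimal cluster is a cluster with no proper subset being a cluster. Cluster-popping: include each arc $a$ in $S$ independently with probability $1-p_a$ (one random variable per arc); while $(V,S)$ has a cluster, let $C_1,\dots,C_k$ be all minimal clusters of $(V,S)$ and independently re-randomize every arc $u\to w\in A$ with $u\in\bigcup_i C_i$ (each included with probability $1-p_{u\to w}$); output $S$. The output is distributed over root-connected subgraphs $S$ (every vertex has a directed path to $r$) with probability proportional to $\prod_{a\in S}(1-p_a)\prod_{a\notin S}p_a$.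
   Formalization: The formal theorem also assumes that p takes the same value on each arc u→v and its reversal v→u; without this the stated bound is false (for example on a three-vertex path rooted at an end, with p=0.99 on both arcs towards the root and p=0.01 on the arc between the two non-root vertices going away). *)

theory Defs
  imports "HOL-Probability.Probability" "Graph_Theory.Graph_Theory"
begin

(* Clusters are taken to be nonempty: otherwise the empty set would be the only minimal cluster
   of every subgraph and cluster-popping would never stop. *)
definition cluster :: "'a pair_pre_digraph \<Rightarrow> 'a \<Rightarrow> ('a \<times> 'a) set \<Rightarrow> 'a set \<Rightarrow> bool" where
  "cluster G r S C \<longleftrightarrow>
     C \<noteq> {} \<and> C \<subseteq> pverts G - {r} \<and> \<not> (\<exists>u w. (u, w) \<in> S \<and> u \<in> C \<and> w \<notin> C)"

definition minimal_cluster ::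
    "'a pair_pre_digraph \<Rightarrow> 'a \<Rightarrow> ('a \<times> 'a) set \<Rightarrow> 'a set \<Rightarrow> bool" where
  "minimal_cluster G r S C \<longleftrightarrow> cluster G r S C \<and> \<not> (\<exists>D. D \<subset> C \<and> cluster G r S D)"

definition popped_arcs :: "'a pair_pre_digraph \<Rightarrow> 'a \<Rightarrow> ('a \<times> 'a) set \<Rightarrow> ('a \<times> 'a) set" where
  "popped_arcs G r S = {(u, w) \<in> parcs G. u \<in> \<Union>{C. minimal_cluster G r S C}}"

(* One independent Bernoulli variable per arc in the finite set B; p is the failure probability. *)
definition random_arcs :: "('b \<Rightarrow> real) \<Rightarrow> 'b set \<Rightarrow> 'b set pmf" where
  "random_arcs p B = map_pmf (\<lambda>f. {a \<in> B. f a}) (Pi_pmf B False (\<lambda>a. bernoulli_pmf (1 - p a)))"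

(* The loop is the least fixed point in the ccpo of sub-probability mass functions. The second
   component of the state counts the random variables drawn so far. *)
partial_function (spmf) popping_loop ::
    "'a pair_pre_digraph \<Rightarrow> 'a \<Rightarrow> ('a \<times> 'a \<Rightarrow> real) \<Rightarrow> ('a \<times> 'a) set \<Rightarrow> nat
      \<Rightarrow> (('a \<times> 'a) set \<times> nat) spmf" where
  "popping_loop G r p S k =
     (if \<exists>C. cluster G r S C then
        bind_spmf (spmf_of_pmf (random_arcs p (popped_arcs G r S)))
          (\<lambda>R. popping_loop G r p ((S - popped_arcs G r S) \<union> R) (k + card (popped_arcs G r S)))
      else return_spmf (S, k))"

definition cluster_popping ::
    "'a pair_pre_digraph \<Rightarrow> 'a \<Rightarrow> ('a \<times> 'a \<Rightarrow> real) \<Rightarrow> (('a \<times> 'a) set \<times> nat) spmf" where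
  "cluster_popping G r p =
     bind_spmf (spmf_of_pmf (random_arcs p (parcs G))) (\<lambda>S. popping_loop G r p S (card (parcs G)))"

(* A run that does not terminate (outcome None) counts as infinitely many draws; integrating over
   measure_spmf instead would silently drop the mass of such runs. *)
definition expected_draws :: "'a pair_pre_digraph \<Rightarrow> 'a \<Rightarrow> ('a \<times> 'a \<Rightarrow> real) \<Rightarrow> ennreal" where
  "expected_draws G r p =
     (\<integral>\<^sup>+ x. (case x of None \<Rightarrow> \<infinity> | Some (S, k) \<Rightarrow> of_nat k) \<partial>measure_pmf (cluster_popping G r p))"

end

theory Submission
  imports Defs
begin

text \<open>
  Distinct minimal clusters are disjoint, and whether \<open>C\<close> is one depends only on the arcs leaving the
  vertices of \<open>C\<close>. Hence, given that the minimal clusters of a product-distributed \<open>S\<close> are exactly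
  those in \<open>M\<close>, resampling their arcs leaves a product-distributed set conditioned on having no
  minimal cluster disjoint from \<open>\<Union>M\<close>. This gives a recursion in \<open>X\<close> for the expected number of
  resampled arcs on the event that all minimal clusters meet \<open>X\<close>, solved by \<open>K * F X - Q X\<close>, where
  \<open>F X\<close> is the probability of that event, \<open>Q X\<close> is the expected number of arcs leaving the only
  minimal cluster disjoint from \<open>X\<close> (0 if it is not unique) and \<open>K = Q {} / F {}\<close>. For \<open>X = V\<close> the
  solution is \<open>K\<close>.

  It remains to bound \<open>K\<close> by \<open>p_max * m * n / (1 - p_max)\<close>. If \<open>S\<close> has a unique minimal cluster
  and \<open>u\<close> lies in it, choose an arc \<open>e = (v, v')\<close> from a vertex that does not reach the root to one
  that does, reverse all arcs inside the set \<open>W\<close> of vertices reachable from \<open>v\<close>, and add \<open>e\<close>. The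
  result is root-connected, and \<open>S\<close> is recovered from it, \<open>e\<close> and \<open>u\<close>, because \<open>W\<close> becomes the set
  reachable from \<open>u\<close> without \<open>e\<close>. Moreover \<open>e\<close> separates \<open>u\<close> from the root, so that at most \<open>n\<close>
  choices of \<open>e\<close> occur for each root-connected subgraph and each \<open>u\<close>.
\<close>

section \<open>Clusters and reachability\<close>

lemma rtrancl_closed:
  assumes "(x, y) \<in> S\<^sup>*" "x \<in> C" "\<And>u w. u \<in> C \<Longrightarrow> (u, w) \<in> S \<Longrightarrow> w \<in> C"
  shows "y \<in> C"
  using assms by (induction rule: rtrancl_induct) auto

text \<open>After its last visit to \<open>v\<close>, a walk leaves \<open>v\<close> through a single arc.\<close>

lemma rtrancl_single_exit:
  assumes "(u, t) \<in> S\<^sup>*"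
  shows "\<exists>x. (u, t) \<in> ({(y, z) \<in> S. y = v \<longrightarrow> z = x})\<^sup>*"
  using assms
proof (induction rule: converse_rtrancl_induct)
  case base
  then show ?case by auto
next
  case (step y z)
  define T where "T x = {(y, z) \<in> S. y = v \<longrightarrow> z = x}" for x
  from step.IH obtain x where x: "(z, t) \<in> (T x)\<^sup>*" unfolding T_def by auto
  show ?case
  proof (cases "y = v")
    case False
    then have "(y, z) \<in> T x" using step.hyps by (auto simp: T_def)
    then show ?thesis using x unfolding T_def by (meson converse_rtrancl_into_rtrancl)
  next
    case True
    show ?thesis
    proof (cases "(v, t) \<in> (T x)\<^sup>*")
      case True
      then show ?thesis using \<open>y = v\<close> unfolding T_def by auto
    next
      case False
      \<comment> \<open>In \<open>T x\<close> the vertex \<open>v\<close> does not reach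
        \<open>t\<close>, so a \<open>T x\<close>-walk to \<open>t\<close> never uses an arc out of
        \<open>v\<close> and is also a \<open>T z\<close>-walk.\<close>
      have "(a, t) \<in> (T z)\<^sup>*" if "(a, t) \<in> (T x)\<^sup>*" for a
        using that
      proof (induction rule: converse_rtrancl_induct)
        case (step a b)
        then have "a \<noteq> v" using False by (meson converse_rtrancl_into_rtrancl)
        then have "(a, b) \<in> T z" using step.hyps by (auto simp: T_def)
        then show ?case using step by (meson converse_rtrancl_into_rtrancl)
      qed simp
      from this[OF x] have "(z, t) \<in> (T z)\<^sup>*" .
      moreover have "(y, z) \<in> T z" using step.hyps by (auto simp: T_def)
      ultimately show ?thesis unfolding T_def by (meson converse_rtrancl_into_rtrancl)
    qed
  qed
qed

text \<open>The arcs lying on every walk from \<open>u\<close> to \<open>t\<close>. Requiring that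
  such a walk exists keeps the set from being all of \<open>S\<close> when there is none.\<close>

definition bridges :: "'a \<Rightarrow> 'a \<Rightarrow> 'a rel \<Rightarrow> 'a rel" where
  "bridges u t S = {e \<in> S. (u, t) \<in> S\<^sup>* \<and> (u, t) \<notin> (S - {e})\<^sup>*}"

text \<open>If some walk from \<open>u\<close> to \<open>t\<close> leaves a vertex only through one
  arc, every other arc out of that vertex is avoidable. So each vertex is the tail of at most one
  bridge.\<close>

lemma inj_on_fst_bridges: "inj_on fst (bridges u t S)"
proof (rule inj_onI)
  fix e e' assume e: "e \<in> bridges u t S" and e': "e' \<in> bridges u t S" and eq: "fst e = fst e'"
  obtain x where x: "(u, t) \<in> ({(y, z) \<in> S. y = fst e \<longrightarrow> z = x})\<^sup>*"
    using rtrancl_single_exit[of u t S "fst e"] e by (auto simp: bridges_def)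
  have *: "snd f = x" if f: "f \<in> bridges u t S" "fst f = fst e" for f
  proof (rule ccontr)
    assume "snd f \<noteq> x"
    then have "{(y, z) \<in> S. y = fst e \<longrightarrow> z = x} \<subseteq> S - {f}" using f by auto
    then have "(u, t) \<in> (S - {f})\<^sup>*" using x rtrancl_mono by blast
    then show False using f by (auto simp: bridges_def)
  qed
  show "e = e'" using *[OF e] *[OF e'] eq by (simp add: prod_eq_iff)
qed

lemma card_bridges_le:
  assumes "finite V" "S \<subseteq> V \<times> V"
  shows "card (bridges u t S) \<le> card V"
  using assms by (intro card_inj_on_le[OF inj_on_fst_bridges]) (auto simp: bridges_def)

text \<open>The subgraph obtained from \<open>S\<close> by reversing the arcs inside \<open>W\<close> is the preimage
  \<open>reverse_in W -` S\<close>.\<close>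

definition reverse_in :: "'a set \<Rightarrow> 'a \<times> 'a \<Rightarrow> 'a \<times> 'a" where
  "reverse_in W a = (if a \<in> W \<times> W then prod.swap a else a)"

lemma reverse_in_reverse_in [simp]: "reverse_in W (reverse_in W a) = a"
  by (auto simp: reverse_in_def)

section \<open>Minimal clusters in a rooted bi-directed graph\<close>

locale rooted_graph =
  fixes G :: "'a pair_pre_digraph" and r :: 'a
  assumes finite_verts: "finite (pverts G)"
    and arcs_subset: "parcs G \<subseteq> pverts G \<times> pverts G"
    and arcs_sym: "\<And>u v. (u, v) \<in> parcs G \<Longrightarrow> (v, u) \<in> parcs G"
    and root_in_verts: "r \<in> pverts G"
    and arcs_reach_root: "\<And>v. v \<in> pverts G \<Longrightarrow> (v, r) \<in> (parcs G)\<^sup>*"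
begin

abbreviation "V \<equiv> pverts G"
abbreviation "A \<equiv> parcs G"

definition out_arcs :: "'a set \<Rightarrow> 'a rel" where
  "out_arcs U = {(u, w) \<in> A. u \<in> U}"

definition mcs :: "'a rel \<Rightarrow> 'a set set" where
  "mcs S = {C. minimal_cluster G r S C}"

lemma finite_arcs: "finite A"
  using finite_verts arcs_subset by (meson finite_SigmaI finite_subset)

lemma popped_arcs_eq: "popped_arcs G r S = out_arcs (\<Union>(mcs S))"
  by (simp add: popped_arcs_def out_arcs_def mcs_def)

lemma out_arcs_subset: "out_arcs U \<subseteq> A"
  by (auto simp: out_arcs_def)

lemma finite_out_arcs [simp]: "finite (out_arcs U)"
  using finite_arcs out_arcs_subset finite_subset by blast

lemma mcs_cluster: "C \<in> mcs S \<Longrightarrow> cluster G r S C"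
  by (simp add: mcs_def minimal_cluster_def)

lemma mcs_subset: "mcs S \<subseteq> Pow (V - {r}) - {{}}"
  by (auto simp: mcs_def minimal_cluster_def cluster_def)

lemma finite_mcs [simp]: "finite (mcs S)"
  by (rule finite_subset[OF mcs_subset]) (use finite_verts in simp)

text \<open>The intersection of two overlapping clusters is again a cluster, so minimality forces it
  to equal both of them.\<close>

lemma mcs_disjoint:
  assumes C: "C \<in> mcs S" and D: "D \<in> mcs S" and "C \<inter> D \<noteq> {}"
  shows "C = D"
proof -
  have CD: "cluster G r S C" "cluster G r S D" using C D by (simp_all add: mcs_cluster)
  have "cluster G r S (C \<inter> D)"
    using CD \<open>C \<inter> D \<noteq> {}\<close> by (auto simp: cluster_def)
  then have "\<not> C \<inter> D \<subset> C" "\<not> C \<inter> D \<subset> D"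
    using C D unfolding mcs_def minimal_cluster_def by blast+
  then show ?thesis by blast
qed

lemma ex_mcs_subset:
  assumes "cluster G r S C"
  shows "\<exists>D \<in> mcs S. D \<subseteq> C"
proof -
  have "finite C" using assms finite_verts finite_subset[of C V] by (auto simp: cluster_def)
  then show ?thesis using assms
  proof (induction C rule: finite_psubset_induct)
    case (psubset C)
    show ?case
    proof (cases "\<exists>D. D \<subset> C \<and> cluster G r S D")
      case True
      then obtain D where D: "D \<subset> C" "cluster G r S D" by blast
      then obtain E where "E \<in> mcs S" "E \<subseteq> D" using psubset.IH[OF D] by blast
      then show ?thesis using D(1) by blast
    next
      case False
      then show ?thesis using psubset.prems unfolding mcs_def minimal_cluster_def by blast
    qed
  qed
qed

lemma mcs_empty_iff: "mcs S = {} \<longleftrightarrow> \<not> (\<exists>C. cluster G r S C)"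
  using ex_mcs_subset mcs_cluster by blast

text \<open>Whether a subset of \<open>C\<close> is a cluster depends on the arcs with tail in
  \<open>C\<close> alone, and minimality compares \<open>C\<close> only with its subsets.\<close>

lemma minimal_cluster_local:
  assumes "S \<inter> out_arcs C = S' \<inter> out_arcs C" "S \<subseteq> A" "S' \<subseteq> A"
  shows "C \<in> mcs S \<longleftrightarrow> C \<in> mcs S'"
proof -
  have *: "(u, w) \<in> S \<longleftrightarrow> (u, w) \<in> S'" if "u \<in> C" for u w
    using assms that by (auto simp: out_arcs_def)
  have "cluster G r S D \<longleftrightarrow> cluster G r S' D" if "D \<subseteq> C" for D
    using * that unfolding cluster_def by blast
  then show ?thesis unfolding mcs_def minimal_cluster_def mem_Collect_eq by blast
qed

lemma reach_in_verts: "S \<subseteq> A \<Longrightarrow> v \<in> V \<Longrightarrow> (v, w) \<in> S\<^sup>* \<Longrightarrow> w \<in> V"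
  using arcs_subset by (auto elim!: rtrancl_closed[where C = V])

lemma cluster_reach:
  assumes "S \<subseteq> A" "v \<in> V" "(v, r) \<notin> S\<^sup>*"
  shows "cluster G r S (S\<^sup>* `` {v})"
  unfolding cluster_def using assms reach_in_verts
  by (auto intro: rtrancl_into_rtrancl)

lemma cluster_not_reach:
  assumes "cluster G r S C" "v \<in> C"
  shows "(v, r) \<notin> S\<^sup>*"
proof
  assume "(v, r) \<in> S\<^sup>*"
  then have "r \<in> C" using assms by (elim rtrancl_closed[where C = C]) (auto simp: cluster_def)
  then show False using assms by (auto simp: cluster_def)
qed

text \<open>A reachable set without the root is a cluster; conversely a walk to the root would have
  to leave any cluster. So the loop stops exactly at root-connected subgraphs.\<close>

lemma mcs_empty_iff_reach:
  assumes "S \<subseteq> A"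
  shows "mcs S = {} \<longleftrightarrow> (\<forall>v \<in> V. (v, r) \<in> S\<^sup>*)"
proof
  assume "mcs S = {}"
  then show "\<forall>v \<in> V. (v, r) \<in> S\<^sup>*" using cluster_reach[OF assms] mcs_empty_iff by blast
next
  assume *: "\<forall>v \<in> V. (v, r) \<in> S\<^sup>*"
  have "\<not> cluster G r S C" for C
  proof
    assume C: "cluster G r S C"
    then obtain v where "v \<in> C" "v \<in> V" by (auto simp: cluster_def)
    then show False using * cluster_not_reach[OF C] by blast
  qed
  then show "mcs S = {}" using mcs_empty_iff by blast
qed

section \<open>Repairing a subgraph with a unique minimal cluster\<close>

lemma ex_boundary_arc:
  assumes "v \<in> V" "(v, r) \<notin> S\<^sup>*"
  shows "\<exists>a \<in> A. (fst a, r) \<notin> S\<^sup>* \<and> (snd a, r) \<in> S\<^sup>*"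
  using arcs_reach_root[OF assms(1)] assms(2)
  by (induction rule: converse_rtrancl_induct) force+

definition boundary_arc :: "'a rel \<Rightarrow> 'a \<times> 'a" where
  "boundary_arc S = (SOME a. a \<in> A \<and> (fst a, r) \<notin> S\<^sup>* \<and> (snd a, r) \<in> S\<^sup>*)"

text \<open>Reversal turns walks from the tail of the boundary arc into walks back to it, and the
  added arc leads from there to a vertex that reaches the root.\<close>

definition repair :: "'a rel \<Rightarrow> 'a rel" where
  "repair S = insert (boundary_arc S) (reverse_in (S\<^sup>* `` {fst (boundary_arc S)}) -` S)"

lemma reverse_in_arcs: "reverse_in W a \<in> A \<longleftrightarrow> a \<in> A"
  using arcs_sym by (auto simp: reverse_in_def)

context
  fixes S :: "'a rel" and C :: "'a set" and u :: 'a
  assumes S: "S \<subseteq> A" and mcs: "mcs S = {C}" and u: "u \<in> C"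
begin

lemma boundary_arc:
  "boundary_arc S \<in> A" "(fst (boundary_arc S), r) \<notin> S\<^sup>*" "(snd (boundary_arc S), r) \<in> S\<^sup>*"
proof -
  have C: "cluster G r S C" using mcs mcs_cluster[of C S] by simp
  have "u \<in> V" using C u by (auto simp: cluster_def)
  then have "\<exists>a. a \<in> A \<and> (fst a, r) \<notin> S\<^sup>* \<and> (snd a, r) \<in> S\<^sup>*"
    using ex_boundary_arc[OF _ cluster_not_reach[OF C u]] by blast
  from someI_ex[OF this]
  show "boundary_arc S \<in> A" "(fst (boundary_arc S), r) \<notin> S\<^sup>*" "(snd (boundary_arc S), r) \<in> S\<^sup>*"
    unfolding boundary_arc_def by blast+
qed

text \<open>The vertices reachable from \<open>v\<close> form a cluster; the minimal cluster inside
  it can only be \<open>C\<close>.\<close>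

lemma reach_unique_mc:
  assumes "v \<in> V" "(v, r) \<notin> S\<^sup>*"
  shows "(v, u) \<in> S\<^sup>*"
  using ex_mcs_subset[OF cluster_reach[OF S assms]] mcs u by auto

lemma boundary_arc_notin: "boundary_arc S \<notin> S"
  using boundary_arc by (metis converse_rtrancl_into_rtrancl prod.collapse)

definition "W = S\<^sup>* `` {fst (boundary_arc S)}"

lemma repair_W: "repair S = insert (boundary_arc S) (reverse_in W -` S)"
  by (simp add: repair_def W_def)

lemma W_closed: "x \<in> W \<Longrightarrow> (x, y) \<in> S \<Longrightarrow> y \<in> W"
  by (auto simp: W_def intro: rtrancl_into_rtrancl)

lemma W_not_reach: "x \<in> W \<Longrightarrow> (x, r) \<notin> S\<^sup>*"
  using boundary_arc(2) by (auto simp: W_def intro: rtrancl_trans)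

lemma boundary_fst: "fst (boundary_arc S) \<in> V" "fst (boundary_arc S) \<in> W"
  using boundary_arc(1) arcs_subset by (auto simp: W_def)

lemma boundary_snd: "snd (boundary_arc S) \<notin> W"
  using boundary_arc(3) W_not_reach by blast

lemma W_subset: "W \<subseteq> V"
  using reach_in_verts[OF S boundary_fst(1)] by (auto simp: W_def)

lemma u_in_W: "u \<in> W"
  using reach_unique_mc[OF boundary_fst(1) boundary_arc(2)] by (simp add: W_def)

lemma reversed_reach:
  assumes "(x, y) \<in> S\<^sup>*" "x \<in> W"
  shows "(y, x) \<in> (reverse_in W -` S)\<^sup>*"
proof -
  have "(y, x) \<in> (reverse_in W -` S)\<^sup>* \<and> y \<in> W"
    using assms
  proof (induction rule: rtrancl_induct)
    case (step y z)
    then have "z \<in> W" using W_closed by blast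
    moreover have "(z, y) \<in> reverse_in W -` S" using step \<open>z \<in> W\<close> by (auto simp: reverse_in_def)
    ultimately show ?case using step by (meson converse_rtrancl_into_rtrancl)
  qed simp
  then show ?thesis by blast
qed

lemma reversed_arcs_from_W: "(x, y) \<in> reverse_in W -` S \<Longrightarrow> x \<in> W \<Longrightarrow> y \<in> W"
  using W_closed by (auto simp: reverse_in_def split: if_splits)

text \<open>No vertex of \<open>W\<close> reaches the root, so each reaches \<open>u\<close>, and
  the reversed walk leads from \<open>u\<close> to it. After the reversal still no arc leaves
  \<open>W\<close>. Hence \<open>W\<close> can be read off from the reversed subgraph and
  \<open>u\<close>.\<close>

lemma reach_from_u_reversed: "(reverse_in W -` S)\<^sup>* `` {u} = W"
proof
  show "(reverse_in W -` S)\<^sup>* `` {u} \<subseteq> W"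
  proof
    fix y assume "y \<in> (reverse_in W -` S)\<^sup>* `` {u}"
    then have "(u, y) \<in> (reverse_in W -` S)\<^sup>*" by simp
    then show "y \<in> W" using u_in_W reversed_arcs_from_W by (rule rtrancl_closed)
  qed
  show "W \<subseteq> (reverse_in W -` S)\<^sup>* `` {u}"
    using reversed_reach reach_unique_mc W_subset W_not_reach by blast
qed

lemma repair_subset: "repair S \<subseteq> A"
proof -
  have "reverse_in W -` S \<subseteq> A" using S reverse_in_arcs by blast
  then show ?thesis using boundary_arc(1) by (simp add: repair_W)
qed

lemma repair_diff: "repair S - {boundary_arc S} = reverse_in W -` S"
proof -
  have "boundary_arc S \<notin> W \<times> W" using boundary_snd by (auto simp: mem_Times_iff)
  then have "boundary_arc S \<notin> reverse_in W -` S"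
    using boundary_arc_notin by (auto simp: reverse_in_def)
  then show ?thesis by (auto simp: repair_W)
qed

text \<open>Vertices that reach the root in \<open>S\<close> do so along walks avoiding
  \<open>W\<close>; those in \<open>W\<close> go through the tail of the added arc; the remaining
  ones have walks to \<open>u\<close>, which enter \<open>W\<close>.\<close>

lemma repair_connected: "mcs (repair S) = {}"
proof -
  let ?T = "repair S"
  have sub: "reverse_in W -` S \<subseteq> ?T" by (auto simp: repair_W)
  have S_T: "(y, z) \<in> ?T" if "(y, z) \<in> S" "y \<notin> W" for y z
    using that sub by (auto simp: reverse_in_def)
  have outside: "(y, r) \<in> ?T\<^sup>*" if "(y, r) \<in> S\<^sup>*" for y
    using that
  proof (induction rule: converse_rtrancl_induct)
    case (step y z)
    have "y \<notin> W" using step.hyps W_not_reach by (meson converse_rtrancl_into_rtrancl)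
    then show ?case using S_T step by (meson converse_rtrancl_into_rtrancl)
  qed simp
  have inside: "(y, r) \<in> ?T\<^sup>*" if "y \<in> W" for y
  proof -
    have "(fst (boundary_arc S), y) \<in> S\<^sup>*" using that by (simp add: W_def)
    then have "(y, fst (boundary_arc S)) \<in> ?T\<^sup>*"
      using reversed_reach boundary_fst(2) rtrancl_mono[OF sub] by blast
    moreover have "boundary_arc S \<in> ?T" by (simp add: repair_W)
    then have "(fst (boundary_arc S), snd (boundary_arc S)) \<in> ?T" by simp
    ultimately show ?thesis
      using outside[OF boundary_arc(3)]
      by (meson converse_rtrancl_into_rtrancl rtrancl_trans)
  qed
  have "(y, r) \<in> ?T\<^sup>*" if "(y, u) \<in> S\<^sup>*" for y
    using that
  proof (induction rule: converse_rtrancl_induct)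
    case base
    show ?case using inside u_in_W by blast
  next
    case (step y z)
    then show ?case
      by (cases "y \<in> W") (use inside S_T in \<open>meson converse_rtrancl_into_rtrancl\<close>)+
  qed
  then have "\<forall>v \<in> V. (v, r) \<in> ?T\<^sup>*" using outside reach_unique_mc by blast
  then show ?thesis using mcs_empty_iff_reach[OF repair_subset] by blast
qed

text \<open>Without the added arc, \<open>u\<close> reaches only \<open>W\<close>, and the root lies
  outside \<open>W\<close>.\<close>

lemma boundary_arc_bridge: "boundary_arc S \<in> bridges u r (repair S)"
proof -
  have "u \<in> V" using u_in_W W_subset by blast
  then have "(u, r) \<in> (repair S)\<^sup>*"
    using mcs_empty_iff_reach[OF repair_subset] repair_connected by blast
  moreover have "r \<notin> W" using W_not_reach by blast
  then have "(u, r) \<notin> (repair S - {boundary_arc S})\<^sup>*"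
    using reach_from_u_reversed unfolding repair_diff by blast
  ultimately show ?thesis by (simp add: bridges_def repair_W)
qed

text \<open>Deleting the added arc exposes \<open>W\<close> as the set reachable from
  \<open>u\<close>, and reversing inside \<open>W\<close> is an involution.\<close>

lemma repair_inverse:
  "S = reverse_in ((repair S - {boundary_arc S})\<^sup>* `` {u}) -` (repair S - {boundary_arc S})"
  unfolding repair_diff reach_from_u_reversed by (simp add: vimage_def)

end

lemma inj_on_repair:
  "inj_on (\<lambda>S. (repair S, boundary_arc S)) {S. S \<subseteq> A \<and> (\<exists>C. mcs S = {C} \<and> u \<in> C)}"
  by (rule inj_onI, clarify) (metis repair_inverse)

end

section \<open>Expectations over random arc sets\<close>

definition arc_weight :: "('b \<Rightarrow> real) \<Rightarrow> 'b set \<Rightarrow> 'b set \<Rightarrow> real" where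
  "arc_weight p B S = (\<Prod>a\<in>B. if a \<in> S then 1 - p a else p a)"

text \<open>The expectation under \<open>random_arcs p B\<close>, written as a finite real sum so
  that differences and exchanged sums need no integrability.\<close>

definition arc_sum :: "('b \<Rightarrow> real) \<Rightarrow> 'b set \<Rightarrow> ('b set \<Rightarrow> real) \<Rightarrow> real" where
  "arc_sum p B f = (\<Sum>S\<in>Pow B. arc_weight p B S * f S)"

lemma set_pmf_random_arcs: "set_pmf (random_arcs p B) \<subseteq> Pow B"
  by (auto simp: random_arcs_def)

lemma pmf_random_arcs:
  assumes "finite B" "\<And>a. a \<in> B \<Longrightarrow> 0 < p a \<and> p a < 1" "S \<subseteq> B"
  shows "pmf (random_arcs p B) S = arc_weight p B S"
proof -
  let ?M = "Pi_pmf B False (\<lambda>a. bernoulli_pmf (1 - p a))"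
  have "set_pmf (bernoulli_pmf (1 - p a)) = UNIV" if "a \<in> B" for a
    using assms(2)[OF that] by (auto simp: set_pmf_bernoulli)
  then have supp: "set_pmf ?M = PiE_dflt B False (\<lambda>_. UNIV)"
    using assms(1) by (auto simp: set_Pi_pmf PiE_dflt_def)
  have inj: "inj_on (\<lambda>f. {a \<in> B. f a}) (set_pmf ?M)"
    unfolding supp by (rule inj_onI) (auto simp: PiE_dflt_def fun_eq_iff set_eq_iff)
  have "pmf (random_arcs p B) {a \<in> B. a \<in> S} = pmf ?M (\<lambda>a. a \<in> S)"
    unfolding random_arcs_def
    by (rule pmf_map_inj[OF inj, of "\<lambda>a. a \<in> S"])
      (use assms(3) in \<open>auto simp: supp PiE_dflt_def\<close>)
  also have "\<dots> = (\<Prod>a\<in>B. pmf (bernoulli_pmf (1 - p a)) (a \<in> S))"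
    using assms(1,3) by (subst pmf_Pi) auto
  also have "\<dots> = arc_weight p B S"
    unfolding arc_weight_def using assms(2)
    by (intro prod.cong) (auto simp: pmf_bernoulli_True pmf_bernoulli_False less_imp_le)
  also have "{a \<in> B. a \<in> S} = S" using assms(3) by auto
  finally show ?thesis .
qed

lemma arc_weight_nonneg:
  assumes "\<And>a. a \<in> B \<Longrightarrow> 0 < p a \<and> p a < (1::real)"
  shows "0 \<le> arc_weight p B S"
  unfolding arc_weight_def using assms by (intro prod_nonneg) (auto simp: less_imp_le)

lemma nn_integral_random_arcs:
  assumes "finite B" "\<And>a. a \<in> B \<Longrightarrow> 0 < p a \<and> p a < 1" "\<And>S. 0 \<le> f S"
  shows "(\<integral>\<^sup>+ S. ennreal (f S) \<partial>measure_pmf (random_arcs p B)) = ennreal (arc_sum p B f)"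
proof -
  have "(\<integral>\<^sup>+ S. ennreal (f S) \<partial>measure_pmf (random_arcs p B))
      = (\<Sum>S\<in>Pow B. ennreal (f S) * ennreal (pmf (random_arcs p B) S))"
    using assms(1) by (intro nn_integral_measure_pmf_support) (auto dest!: subsetD[OF set_pmf_random_arcs])
  also have "\<dots> = (\<Sum>S\<in>Pow B. ennreal (arc_weight p B S * f S))"
    using pmf_random_arcs[OF assms(1,2)] assms(3)
    by (intro sum.cong) (auto simp: ennreal_mult' mult.commute)
  also have "\<dots> = ennreal (arc_sum p B f)"
    unfolding arc_sum_def using arc_weight_nonneg[of B p] assms by (intro sum_ennreal) auto
  finally show ?thesis .
qed

lemma arc_sum_const:
  assumes "finite B" "\<And>a. a \<in> B \<Longrightarrow> 0 < p a \<and> p a < 1"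
  shows "arc_sum p B (\<lambda>_. c) = c"
proof -
  have "(\<Sum>S\<in>Pow B. arc_weight p B S) = (\<Sum>S\<in>Pow B. pmf (random_arcs p B) S)"
    using pmf_random_arcs[OF assms] by (intro sum.cong) auto
  also have "\<dots> = 1"
    using assms(1) set_pmf_random_arcs by (intro sum_pmf_eq_1) auto
  finally show ?thesis by (simp add: arc_sum_def flip: sum_distrib_right)
qed

lemma arc_sum_cong: "(\<And>S. S \<subseteq> B \<Longrightarrow> f S = g S) \<Longrightarrow> arc_sum p B f = arc_sum p B g"
  unfolding arc_sum_def by (intro sum.cong) auto

lemma arc_sum_mono:
  assumes "\<And>a. a \<in> B \<Longrightarrow> 0 < p a \<and> p a < 1" "\<And>S. S \<subseteq> B \<Longrightarrow> f S \<le> g S"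
  shows "arc_sum p B f \<le> arc_sum p B g"
  unfolding arc_sum_def
  using arc_weight_nonneg[of B p] assms by (intro sum_mono mult_left_mono) auto

lemma arc_sum_add: "arc_sum p B (\<lambda>S. f S + g S) = arc_sum p B f + arc_sum p B g"
  by (simp add: arc_sum_def distrib_left sum.distrib)

lemma arc_sum_cmult: "arc_sum p B (\<lambda>S. c * f S) = c * arc_sum p B f"
  by (simp add: arc_sum_def sum_distrib_left mult.left_commute)

lemma arc_sum_sum: "arc_sum p B (\<lambda>S. \<Sum>i\<in>I. f i S) = (\<Sum>i\<in>I. arc_sum p B (f i))"
  unfolding arc_sum_def sum_distrib_left by (rule sum.swap)

lemma arc_sum_split:
  assumes "finite A" "B \<subseteq> A"
  shows "arc_sum p A f = arc_sum p B (\<lambda>R. arc_sum p (A - B) (\<lambda>T. f (R \<union> T)))"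
proof -
  have w: "arc_weight p A (R \<union> T) = arc_weight p B R * arc_weight p (A - B) T"
    if "R \<subseteq> B" "T \<subseteq> A - B" for R T
  proof -
    have "arc_weight p A (R \<union> T) = (\<Prod>a\<in>A - B. if a \<in> R \<union> T then 1 - p a else p a)
        * (\<Prod>a\<in>B. if a \<in> R \<union> T then 1 - p a else p a)"
      unfolding arc_weight_def using assms by (intro prod.subset_diff) auto
    moreover have "(\<Prod>a\<in>A - B. if a \<in> R \<union> T then 1 - p a else p a) = arc_weight p (A - B) T"
      unfolding arc_weight_def using that by (intro prod.cong) auto
    moreover have "(\<Prod>a\<in>B. if a \<in> R \<union> T then 1 - p a else p a) = arc_weight p B R"
      unfolding arc_weight_def using that by (intro prod.cong) auto
    ultimately show ?thesis by simp
  qed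
  have "arc_sum p A f = (\<Sum>(R, T)\<in>Pow B \<times> Pow (A - B). arc_weight p A (R \<union> T) * f (R \<union> T))"
    unfolding arc_sum_def
    by (rule sum.reindex_bij_witness[where i = "\<lambda>(R, T). R \<union> T" and j = "\<lambda>S. (S \<inter> B, S - B)"])
      (use assms in \<open>auto simp: Int_Diff_Un Un_Diff_Int\<close>)
  also have "\<dots> = (\<Sum>(R, T)\<in>Pow B \<times> Pow (A - B).
      arc_weight p B R * (arc_weight p (A - B) T * f (R \<union> T)))"
    using w by (intro sum.cong) (auto simp: mult.assoc)
  also have "\<dots> = arc_sum p B (\<lambda>R. arc_sum p (A - B) (\<lambda>T. f (R \<union> T)))"
    by (simp add: arc_sum_def sum_distrib_left flip: sum.cartesian_product)
  finally show ?thesis .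
qed

lemma arc_sum_indep:
  assumes A: "finite A" "B \<subseteq> A" and p: "\<And>a. a \<in> A \<Longrightarrow> 0 < p a \<and> p a < 1"
    and f: "\<And>S. S \<subseteq> A \<Longrightarrow> f S = f (S \<inter> B)" and g: "\<And>S. S \<subseteq> A \<Longrightarrow> g S = g (S - B)"
  shows "arc_sum p A (\<lambda>S. f S * g S) = arc_sum p A f * arc_sum p A g"
proof -
  have f': "f (R \<union> T) = f R" and g': "g (R \<union> T) = g T" if "R \<subseteq> B" "T \<subseteq> A - B" for R T
  proof -
    have *: "R \<union> T \<subseteq> A" "(R \<union> T) \<inter> B = R" "(R \<union> T) - B = T" using that A(2) by auto
    show "f (R \<union> T) = f R" "g (R \<union> T) = g T" using f[OF *(1)] g[OF *(1)] * by simp_all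
  qed
  have fin: "finite B" "finite (A - B)" using A finite_subset by auto
  have pB: "\<And>a. a \<in> B \<Longrightarrow> 0 < p a \<and> p a < 1" "\<And>a. a \<in> A - B \<Longrightarrow> 0 < p a \<and> p a < 1"
    using p A(2) by auto
  have "arc_sum p A h = arc_sum p B (\<lambda>R. arc_sum p (A - B) (\<lambda>T. h' R T))"
    if "\<And>R T. R \<subseteq> B \<Longrightarrow> T \<subseteq> A - B \<Longrightarrow> h (R \<union> T) = h' R T" for h h'
    unfolding arc_sum_split[OF A] using that by (intro arc_sum_cong) auto
  note * = this
  have "arc_sum p A f = arc_sum p B f"
    using *[of f "\<lambda>R T. f R"] f' arc_sum_const[OF fin(2) pB(2)] by simp
  moreover have "arc_sum p A g = arc_sum p (A - B) g"
    using *[of g "\<lambda>R T. g T"] g' arc_sum_const[OF fin(1) pB(1)] by simp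
  moreover have "arc_sum p A (\<lambda>S. f S * g S) = arc_sum p B (\<lambda>R. arc_sum p (A - B) g * f R)"
    by (subst *[where h' = "\<lambda>R T. f R * g T"]) (simp_all add: f' g' arc_sum_cmult mult.commute)
  ultimately show ?thesis by (simp add: arc_sum_cmult)
qed

text \<open>Fresh arcs in \<open>B\<close> with the old arcs elsewhere again have the product
  distribution; the discarded part sums out.\<close>

lemma arc_sum_resample:
  assumes A: "finite A" "B \<subseteq> A" and p: "\<And>a. a \<in> A \<Longrightarrow> 0 < p a \<and> p a < 1"
  shows "arc_sum p A (\<lambda>S. arc_sum p B (\<lambda>R. k (S - B \<union> R))) = arc_sum p A k"
proof -
  have fin: "finite B" using A finite_subset by auto
  have pB: "\<And>a. a \<in> B \<Longrightarrow> 0 < p a \<and> p a < 1" using p A(2) by auto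
  have "arc_sum p A (\<lambda>S. arc_sum p B (\<lambda>R. k (S - B \<union> R)))
      = arc_sum p B (\<lambda>_. arc_sum p (A - B) (\<lambda>T. arc_sum p B (\<lambda>R. k (R \<union> T))))"
    unfolding arc_sum_split[OF A]
  proof (intro arc_sum_cong)
    fix Q T R assume "Q \<subseteq> B" "T \<subseteq> A - B"
    then have "Q \<union> T - B = T" by auto
    then show "k (Q \<union> T - B \<union> R) = k (R \<union> T)" by (simp add: Un_commute)
  qed
  also have "\<dots> = arc_sum p (A - B) (\<lambda>T. arc_sum p B (\<lambda>R. k (R \<union> T)))"
    by (rule arc_sum_const[OF fin pB])
  also have "\<dots> = arc_sum p B (\<lambda>R. arc_sum p (A - B) (\<lambda>T. k (R \<union> T)))"
    unfolding arc_sum_def sum_distrib_left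
    by (subst sum.swap) (simp add: mult.left_commute)
  also have "\<dots> = arc_sum p A k" unfolding arc_sum_split[OF A] ..
  finally show ?thesis .
qed

section \<open>The recursion for the number of resampled arcs\<close>

locale weighted_rooted_graph = rooted_graph +
  fixes p :: "'a \<times> 'a \<Rightarrow> real"
  assumes p_range: "\<And>a. a \<in> parcs G \<Longrightarrow> 0 < p a \<and> p a < 1"
begin

abbreviation "E f \<equiv> arc_sum p A f"

definition mcs_off :: "'a set \<Rightarrow> 'a rel \<Rightarrow> 'a set set" where
  "mcs_off X S = {C \<in> mcs S. C \<inter> X = {}}"

definition solo :: "'a set set \<Rightarrow> real" where
  "solo M = (if is_singleton M then real (card (out_arcs (\<Union>M))) else 0)"

definition F :: "'a set \<Rightarrow> real" where
  "F X = E (\<lambda>S. of_bool (mcs_off X S = {}))"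

definition Q :: "'a set \<Rightarrow> real" where
  "Q X = E (\<lambda>S. solo (mcs_off X S))"

text \<open>Containment instead of equality makes this event depend only on the arcs with tail in
  \<open>\<Union>M\<close>.\<close>

definition prob_mcs :: "'a set set \<Rightarrow> real" where
  "prob_mcs M = E (\<lambda>S. of_bool (M \<subseteq> mcs S))"

definition families :: "'a set \<Rightarrow> 'a set set set" where
  "families X = {M. M \<subseteq> Pow V \<and> (\<forall>C\<in>M. C \<inter> X \<noteq> {})}"

text \<open>One round of the loop with continuation cost \<open>Z\<close>. Iterating
  \<open>N\<close> times from a constant \<open>b\<close> charges the arcs popped in the first
  \<open>N\<close> rounds, plus \<open>b\<close> to runs that make all of them.\<close>

definition pop_step :: "('a rel \<Rightarrow> real) \<Rightarrow> 'a rel \<Rightarrow> real" where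
  "pop_step Z S = (if mcs S = {} then 0 else
     let B = out_arcs (\<Union>(mcs S)) in real (card B) + arc_sum p B (\<lambda>R. Z (S - B \<union> R)))"

lemma p_range_sub: "B \<subseteq> A \<Longrightarrow> a \<in> B \<Longrightarrow> 0 < p a \<and> p a < 1"
  using p_range by blast

lemma E_const: "E (\<lambda>_. c) = c"
  by (rule arc_sum_const[OF finite_arcs]) (rule p_range)

lemma E_mono: "(\<And>S. S \<subseteq> A \<Longrightarrow> f S \<le> g S) \<Longrightarrow> E f \<le> E g"
  by (rule arc_sum_mono) (rule p_range)

lemma E_resample: "E (\<lambda>S. arc_sum p (out_arcs U) (\<lambda>R. k (S - out_arcs U \<union> R))) = E k"
  by (rule arc_sum_resample[OF finite_arcs out_arcs_subset]) (rule p_range)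

lemma finite_families [simp]: "finite (families X)"
  unfolding families_def using finite_verts by (rule_tac finite_subset[of _ "Pow (Pow V)"]) auto

lemma mcs_in_families: "mcs S \<in> families X \<longleftrightarrow> mcs_off X S = {}"
  using mcs_subset[of S] by (auto simp: families_def mcs_off_def)

lemma mcs_off_Union:
  assumes "M \<subseteq> mcs S"
  shows "mcs_off (\<Union>M) S = mcs S - M"
proof -
  have "C \<inter> \<Union>M = {} \<longleftrightarrow> C \<notin> M" if C: "C \<in> mcs S" for C
  proof
    have "C \<noteq> {}" using C mcs_subset by blast
    then show "C \<inter> \<Union>M = {} \<Longrightarrow> C \<notin> M" by blast
    show "C \<inter> \<Union>M = {}" if "C \<notin> M"
    proof (rule ccontr)
      assume "C \<inter> \<Union>M \<noteq> {}"
      then obtain D where "D \<in> M" "C \<inter> D \<noteq> {}" by blast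
      then show False using mcs_disjoint[OF C, of D] assms that by blast
    qed
  qed
  then show ?thesis by (auto simp: mcs_off_def)
qed

text \<open>This splits the event that \<open>M\<close> is the set of all minimal clusters into one
  about the arcs with tail in \<open>\<Union>M\<close> and one about the remaining arcs.\<close>

lemma mcs_eq_iff:
  "M = mcs S \<longleftrightarrow> M \<subseteq> mcs S \<and> mcs_off (\<Union>M) S = {}"
  using mcs_off_Union[of M S] by auto

lemma subset_mcs_local:
  assumes "S \<subseteq> A"
  shows "M \<subseteq> mcs S \<longleftrightarrow> M \<subseteq> mcs (S \<inter> out_arcs (\<Union>M))"
proof -
  have "C \<in> mcs S \<longleftrightarrow> C \<in> mcs (S \<inter> out_arcs (\<Union>M))" if "C \<in> M" for C
    using that assms by (intro minimal_cluster_local) (auto simp: out_arcs_def)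
  then show ?thesis by blast
qed

lemma mcs_off_local:
  assumes "S \<subseteq> A"
  shows "mcs_off X S = mcs_off X (S - out_arcs X)"
proof -
  have "C \<in> mcs S \<longleftrightarrow> C \<in> mcs (S - out_arcs X)" if "C \<inter> X = {}" for C
    using that assms by (intro minimal_cluster_local) (auto simp: out_arcs_def)
  then show ?thesis unfolding mcs_off_def by blast
qed

lemma E_family:
  assumes h: "\<And>S. S \<subseteq> A \<Longrightarrow> h S = h (S - out_arcs (\<Union>M))"
  shows "E (\<lambda>S. of_bool (M \<subseteq> mcs S) * h S) = prob_mcs M * E h"
  unfolding prob_mcs_def
  by (rule arc_sum_indep[OF finite_arcs out_arcs_subset])
    (use p_range h subset_mcs_local in auto)

text \<open>Sum over the exact set of minimal clusters; the probability that it is \<open>M\<close>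
  factors as \<open>prob_mcs M * F (\<Union>M)\<close>.\<close>

lemma F_sum: "F X = (\<Sum>M\<in>families X. prob_mcs M * F (\<Union>M))"
proof -
  have "F X = E (\<lambda>S. \<Sum>M\<in>families X. of_bool (M \<subseteq> mcs S) * of_bool (mcs_off (\<Union>M) S = {}))"
    unfolding F_def
  proof (intro arc_sum_cong)
    fix S
    have "(\<Sum>M\<in>families X. of_bool (M \<subseteq> mcs S) * of_bool (mcs_off (\<Union>M) S = {}))
        = (\<Sum>M\<in>families X. if M = mcs S then 1 else (0::real))"
      by (intro sum.cong refl) (auto simp: mcs_eq_iff)
    then show "of_bool (mcs_off X S = {})
        = (\<Sum>M\<in>families X. of_bool (M \<subseteq> mcs S) * of_bool (mcs_off (\<Union>M) S = {}) :: real)"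
      by (simp add: mcs_in_families)
  qed
  also have "\<dots> = (\<Sum>M\<in>families X. prob_mcs M * F (\<Union>M))"
    unfolding arc_sum_sum F_def
    by (intro sum.cong refl E_family) (subst mcs_off_local, assumption, rule refl)
  finally show ?thesis .
qed

lemma prob_mcs_empty [simp]: "prob_mcs {} = 1"
  by (simp add: prob_mcs_def E_const)

lemma card_out_arcs_Union_mcs:
  assumes "M \<subseteq> mcs S"
  shows "card (out_arcs (\<Union>M)) = (\<Sum>C\<in>M. card (out_arcs C))"
proof -
  have "out_arcs (\<Union>M) = (\<Union>C\<in>M. out_arcs C)" by (auto simp: out_arcs_def)
  moreover have "finite M" using assms finite_mcs finite_subset by blast
  moreover have "\<forall>C\<in>M. \<forall>D\<in>M. C \<noteq> D \<longrightarrow> out_arcs C \<inter> out_arcs D = {}"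
    using mcs_disjoint[of _ S] assms by (fastforce simp: out_arcs_def)
  ultimately show ?thesis by (simp add: card_UN_disjoint)
qed

text \<open>A term is nonzero only if \<open>M\<close> is \<open>mcs S\<close> without one member
  \<open>C\<close> and all members of \<open>M\<close> meet \<open>X\<close>; it then equals
  \<open>card (out_arcs C)\<close>.\<close>

lemma sum_solo:
  "(\<Sum>M\<in>families X. of_bool (M \<subseteq> mcs S) * solo (mcs_off (\<Union>M) S))
    = of_bool (mcs_off X S = {}) * card (out_arcs (\<Union>(mcs S))) + solo (mcs_off X S)"
    (is "?L = ?R")
proof -
  let ?N = "mcs S"
  let ?ok = "\<lambda>C. \<forall>D\<in>?N - {C}. D \<inter> X \<noteq> {}"
  have N: "?N \<subseteq> Pow V" using mcs_subset by blast
  have "?L = (\<Sum>M\<in>(\<lambda>C. ?N - {C}) ` {C \<in> ?N. ?ok C}. solo (?N - M))"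
  proof (rule sum.mono_neutral_cong_right)
    show "(\<lambda>C. ?N - {C}) ` {C \<in> ?N. ?ok C} \<subseteq> families X"
      using N by (auto simp: families_def)
    show "\<forall>M\<in>families X - (\<lambda>C. ?N - {C}) ` {C \<in> ?N. ?ok C}.
        of_bool (M \<subseteq> ?N) * solo (mcs_off (\<Union>M) S) = 0"
    proof (rule ballI, rule ccontr)
      fix M assume M: "M \<in> families X - (\<lambda>C. ?N - {C}) ` {C \<in> ?N. ?ok C}"
        and nz: "of_bool (M \<subseteq> ?N) * solo (mcs_off (\<Union>M) S) \<noteq> 0"
      then have sub: "M \<subseteq> ?N" by (auto split: if_splits)
      then have "is_singleton (?N - M)"
        using nz by (auto simp: mcs_off_Union solo_def split: if_splits)
      then obtain C where C: "?N - M = {C}" by (auto simp: is_singleton_def)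
      then have "M = ?N - {C}" "C \<in> ?N" using sub by auto
      moreover from this have "?ok C" using M by (auto simp: families_def)
      ultimately show False using M by blast
    qed
  qed (auto simp: mcs_off_Union)
  also have "\<dots> = (\<Sum>C\<in>{C \<in> ?N. ?ok C}. solo {C})"
  proof (subst sum.reindex)
    show "inj_on (\<lambda>C. ?N - {C}) {C \<in> ?N. ?ok C}" by (rule inj_onI) blast
    have "?N - (?N - {C}) = {C}" if "C \<in> ?N" for C using that by auto
    then show "sum ((\<lambda>M. solo (?N - M)) \<circ> (\<lambda>C. ?N - {C})) {C \<in> ?N. ?ok C}
        = (\<Sum>C\<in>{C \<in> ?N. ?ok C}. solo {C})"
      by (intro sum.cong) auto
  qed
  also have "\<dots> = (\<Sum>C\<in>{C \<in> ?N. ?ok C}. real (card (out_arcs C)))"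
    by (simp add: solo_def)
  also have "\<dots> = ?R"
  proof -
    \<comment> \<open>The removed member is arbitrary if all minimal clusters meet \<open>X\<close>,
      is forced if exactly one misses \<open>X\<close>, and does not exist if two miss it.\<close>
    consider "mcs_off X S = {}" | D where "mcs_off X S = {D}"
      | D D' where "D \<in> mcs_off X S" "D' \<in> mcs_off X S" "D \<noteq> D'" by blast
    then show ?thesis
    proof cases
      case 1
      then have "{C \<in> ?N. ?ok C} = ?N" by (auto simp: mcs_off_def)
      then show ?thesis using 1
        by (simp add: card_out_arcs_Union_mcs[of ?N S] solo_def is_singleton_def)
    next
      case (2 D)
      then have "{C \<in> ?N. ?ok C} = {D}" unfolding mcs_off_def by blast
      then show ?thesis using 2 by (simp add: solo_def)
    next
      case (3 D D')
      then have "{C \<in> ?N. ?ok C} = {}" unfolding mcs_off_def by blast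
      moreover have "\<not> is_singleton (mcs_off X S)"
        using 3 by (auto simp: is_singleton_def)
      moreover have "mcs_off X S \<noteq> {}" using 3 by blast
      ultimately show ?thesis by (simp add: solo_def del: Collect_empty_eq)
    qed
  qed
  finally show ?thesis .
qed

text \<open>Both sides count the pairs of a possible set of minimal clusters and one distinguished member,
  where all the others meet \<open>X\<close>; the distinguished one may or may not meet \<open>X\<close>.\<close>

lemma Q_sum:
  "(\<Sum>M\<in>families X. prob_mcs M * Q (\<Union>M))
    = (\<Sum>M\<in>families X. prob_mcs M * (card (out_arcs (\<Union>M)) * F (\<Union>M))) + Q X"
proof -
  have "(\<Sum>M\<in>families X. prob_mcs M * Q (\<Union>M))
      = E (\<lambda>S. \<Sum>M\<in>families X. of_bool (M \<subseteq> mcs S) * solo (mcs_off (\<Union>M) S))"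
    unfolding arc_sum_sum Q_def
    by (intro sum.cong refl E_family[symmetric]) (subst mcs_off_local, assumption, rule refl)
  also have "\<dots> = E (\<lambda>S. of_bool (mcs_off X S = {}) * card (out_arcs (\<Union>(mcs S)))) + Q X"
    by (simp only: sum_solo arc_sum_add Q_def)
  also have "E (\<lambda>S. of_bool (mcs_off X S = {}) * card (out_arcs (\<Union>(mcs S))))
     = E (\<lambda>S. \<Sum>M\<in>families X. of_bool (M \<subseteq> mcs S)
         * (real (card (out_arcs (\<Union>M))) * of_bool (mcs_off (\<Union>M) S = {})))"
  proof (intro arc_sum_cong)
    fix S
    have "(\<Sum>M\<in>families X. of_bool (M \<subseteq> mcs S)
          * (real (card (out_arcs (\<Union>M))) * of_bool (mcs_off (\<Union>M) S = {})))
        = (\<Sum>M\<in>families X. if M = mcs S then real (card (out_arcs (\<Union>M))) else 0)"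
      by (intro sum.cong refl) (auto simp: mcs_eq_iff)
    then show "of_bool (mcs_off X S = {}) * card (out_arcs (\<Union>(mcs S)))
        = (\<Sum>M\<in>families X. of_bool (M \<subseteq> mcs S)
          * (real (card (out_arcs (\<Union>M))) * of_bool (mcs_off (\<Union>M) S = {})))"
      by (simp add: mcs_in_families)
  qed
  also have "\<dots> = (\<Sum>M\<in>families X. prob_mcs M * (card (out_arcs (\<Union>M)) * F (\<Union>M)))"
  proof -
    have "card (out_arcs (\<Union>M)) * F (\<Union>M)
        = E (\<lambda>S. real (card (out_arcs (\<Union>M))) * of_bool (mcs_off (\<Union>M) S = {}))" for M
      by (simp add: F_def arc_sum_cmult)
    then show ?thesis
      unfolding arc_sum_sum
      by (simp only:) (intro sum.cong refl E_family, subst mcs_off_local, assumption, rule refl)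
  qed
  finally show ?thesis .
qed

text \<open>Given that \<open>M\<close> is the set of minimal clusters, a pop resamples the arcs
  with tail in \<open>\<Union>M\<close> and keeps the condition on the others. So the new state is
  product-distributed conditioned on the event for \<open>\<Union>M\<close>. The empty family is
  left out because the loop has then stopped.\<close>

lemma E_pop_step:
  "E (\<lambda>S. of_bool (mcs_off X S = {}) * pop_step Z S)
    = (\<Sum>M\<in>families X - {{}}. prob_mcs M * (card (out_arcs (\<Union>M)) * F (\<Union>M)
        + E (\<lambda>S. of_bool (mcs_off (\<Union>M) S = {}) * Z S)))"
proof -
  let ?B = "\<lambda>M. out_arcs (\<Union>M)"
  let ?free = "\<lambda>M S. of_bool (mcs_off (\<Union>M) S = {}) :: real"
  let ?h = "\<lambda>M S. ?free M S * card (?B M)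
      + arc_sum p (?B M) (\<lambda>R. ?free M (S - ?B M \<union> R) * Z (S - ?B M \<union> R))"
  \<comment> \<open>Resampling does not touch the arcs that decide this event, so its indicator may
    move inside the inner sum.\<close>
  have free: "?free M S = ?free M (S - ?B M \<union> R)" if "S \<subseteq> A" "R \<subseteq> ?B M" for M S R
  proof -
    have "S - ?B M \<union> R \<subseteq> A" using that out_arcs_subset by blast
    moreover have "S - ?B M \<union> R - ?B M = S - ?B M" using that(2) by blast
    ultimately show ?thesis using mcs_off_local that(1) by metis
  qed
  have "E (\<lambda>S. of_bool (mcs_off X S = {}) * pop_step Z S)
      = E (\<lambda>S. \<Sum>M\<in>families X - {{}}. of_bool (M \<subseteq> mcs S) * ?h M S)"
  proof (intro arc_sum_cong)
    fix S assume S: "S \<subseteq> A"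
    have "of_bool (M \<subseteq> mcs S) * ?h M S = (if M = mcs S then pop_step Z S else 0)"
      if "M \<noteq> {}" for M
    proof -
      have h: "?h M S = ?free M S * (card (?B M) + arc_sum p (?B M) (\<lambda>R. Z (S - ?B M \<union> R)))"
        unfolding distrib_left arc_sum_cmult[symmetric]
        using free[OF S] by (intro arg_cong2[of _ _ _ _ "(+)"] refl arc_sum_cong) simp
      show ?thesis
        unfolding h using mcs_eq_iff[of M S] that by (auto simp: pop_step_def Let_def)
    qed
    then have "(\<Sum>M\<in>families X - {{}}. of_bool (M \<subseteq> mcs S) * ?h M S)
        = (\<Sum>M\<in>families X - {{}}. if M = mcs S then pop_step Z S else 0)"
      by (intro sum.cong) auto
    then show "of_bool (mcs_off X S = {}) * pop_step Z S
        = (\<Sum>M\<in>families X - {{}}. of_bool (M \<subseteq> mcs S) * ?h M S)"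
      by (auto simp: mcs_in_families pop_step_def)
  qed
  also have "\<dots> = (\<Sum>M\<in>families X - {{}}. prob_mcs M * E (?h M))"
    unfolding arc_sum_sum
  proof (intro sum.cong refl E_family)
    fix M S assume "S \<subseteq> A"
    then show "?h M S = ?h M (S - ?B M)" using free[of S "{}" M] by simp
  qed
  also have "\<dots> = (\<Sum>M\<in>families X - {{}}. prob_mcs M * (card (?B M) * F (\<Union>M)
        + E (\<lambda>S. ?free M S * Z S)))"
    unfolding arc_sum_add E_resample[of _ "\<lambda>S. of_bool (mcs_off (\<Union>_) S = {}) * Z S"]
    by (simp add: F_def mult.commute[of "of_bool _" "real (card _)"] arc_sum_cmult)
  finally show ?thesis .
qed

section \<open>Bounds and iteration of the recursion\<close>

lemma prob_mcs_nonneg: "0 \<le> prob_mcs M"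
  using E_mono[of "\<lambda>_. 0" "\<lambda>S. of_bool (M \<subseteq> mcs S)"] by (simp add: prob_mcs_def E_const)

lemma F_le_1: "F X \<le> 1"
  using E_mono[of "\<lambda>S. of_bool (mcs_off X S = {})" "\<lambda>_. 1"] by (simp add: F_def E_const)

lemma F_mono: "F {} \<le> F X"
  unfolding F_def by (rule E_mono) (auto simp: mcs_off_def)

lemma arc_weight_pos: "0 < arc_weight p A S"
  unfolding arc_weight_def using p_range by (intro prod_pos) auto

text \<open>The full arc set is root-connected and has positive weight.\<close>

lemma F_empty_pos: "0 < F {}"
proof -
  have "mcs A = {}" using mcs_empty_iff_reach[of A] arcs_reach_root by auto
  then have "arc_weight p A A \<le> F {}"
    unfolding F_def arc_sum_def
    using member_le_sum[of A "Pow A" "\<lambda>S. arc_weight p A S * of_bool (mcs_off {} S = {})"]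
      arc_weight_nonneg[of A p] p_range finite_arcs by (auto simp: mcs_off_def)
  then show ?thesis using arc_weight_pos[of A] by linarith
qed

lemma Q_bounds: "0 \<le> Q X" "Q X \<le> card A"
proof -
  have "0 \<le> solo M" "solo M \<le> card A" for M
    by (auto simp: solo_def card_mono[OF finite_arcs out_arcs_subset])
  then show "0 \<le> Q X" "Q X \<le> card A"
    using E_mono[of "\<lambda>_. 0" "\<lambda>S. solo (mcs_off X S)"]
      E_mono[of "\<lambda>S. solo (mcs_off X S)" "\<lambda>_. card A"] by (simp_all add: Q_def E_const)
qed

definition K :: real where "K = Q {} / F {}"

text \<open>\<open>K * F X - Q X\<close> is the exact value of the limit; the extra term absorbs the runs that are
  still going on after \<open>N\<close> steps.\<close>

lemma E_iterate_pop_step: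
  assumes "0 \<le> b"
  shows "E (\<lambda>S. of_bool (mcs_off X S = {}) * (pop_step ^^ N) (\<lambda>_. b) S)
    \<le> K * F X - Q X + (b + card A / F {}) * (1 - F {}) ^ N * F X"
proof (induction N arbitrary: X)
  case 0
  \<comment> \<open>As \<open>F X / F {}\<close> is at least 1, the summand
    \<open>card A / F {}\<close> pays for \<open>- Q X\<close> at \<open>N = 0\<close>.\<close>
  have "real (card A) * 1 \<le> real (card A) * (F X / F {})"
    using F_mono[of X] F_empty_pos by (intro mult_left_mono) (simp_all add: field_simps)
  moreover have "0 \<le> K * F X" 
    using Q_bounds F_mono[of X] F_empty_pos by (auto simp: K_def)
  moreover have "E (\<lambda>S. of_bool (mcs_off X S = {}) * b) = b * F X"
    by (simp add: F_def E_resample[of _ "\<lambda>S. of_bool (_ S) * _ S"] mult.commute[of _ b] arc_sum_cmult)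
  ultimately show ?case using Q_bounds[of X] by (simp add: distrib_right)
next
  case (Suc N)
  let ?c = "(b + card A / F {}) * (1 - F {}) ^ N"
  let ?P = "families X - {{}}"
  have mem: "{} \<in> families X" by (simp add: families_def)
  have split: "(\<Sum>M\<in>families X. f M) = f {} + (\<Sum>M\<in>?P. f M)" for f :: "'a set set \<Rightarrow> real"
    by (rule sum.remove[OF finite_families mem])
  have c: "0 \<le> ?c" using assms F_empty_pos F_le_1[of "{}"] by simp
  have "E (\<lambda>S. of_bool (mcs_off X S = {}) * (pop_step ^^ Suc N) (\<lambda>_. b) S)
      \<le> (\<Sum>M\<in>?P. prob_mcs M * (card (out_arcs (\<Union>M)) * F (\<Union>M)
          + (K * F (\<Union>M) - Q (\<Union>M) + ?c * F (\<Union>M))))"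
    unfolding funpow.simps o_def E_pop_step
    using Suc.IH prob_mcs_nonneg by (intro sum_mono mult_left_mono add_left_mono) auto
  also have "\<dots> = (\<Sum>M\<in>?P. prob_mcs M * (card (out_arcs (\<Union>M)) * F (\<Union>M)))
      - (\<Sum>M\<in>?P. prob_mcs M * Q (\<Union>M)) + (K + ?c) * (\<Sum>M\<in>?P. prob_mcs M * F (\<Union>M))"
    unfolding sum_distrib_left sum_subtractf[symmetric] sum.distrib[symmetric]
    by (intro sum.cong) (auto simp: algebra_simps)
  also have "(\<Sum>M\<in>?P. prob_mcs M * F (\<Union>M)) = F X - F {}"
    using F_sum[of X] split[of "\<lambda>M. prob_mcs M * F (\<Union>M)"] by simp
  also have "(\<Sum>M\<in>?P. prob_mcs M * (card (out_arcs (\<Union>M)) * F (\<Union>M)))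
      = (\<Sum>M\<in>?P. prob_mcs M * Q (\<Union>M)) + Q {} - Q X"
    using Q_sum[of X] split[of "\<lambda>M. prob_mcs M * (card (out_arcs (\<Union>M)) * F (\<Union>M))"]
      split[of "\<lambda>M. prob_mcs M * Q (\<Union>M)"] by (simp add: out_arcs_def)
  \<comment> \<open>The choice of \<open>K\<close> makes \<open>K * F {}\<close> cancel
    \<open>Q {}\<close>.\<close>
  also have "(\<Sum>M\<in>?P. prob_mcs M * Q (\<Union>M)) + Q {} - Q X - (\<Sum>M\<in>?P. prob_mcs M * Q (\<Union>M))
        + (K + ?c) * (F X - F {}) = K * F X - Q X + ?c * (F X - F {})"
    using F_empty_pos by (simp add: K_def field_simps)
  also have "\<dots> \<le> K * F X - Q X + ?c * ((1 - F {}) * F X)"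
  proof -
    \<comment> \<open>\<open>F X \<le> 1\<close> turns the loss of \<open>F {}\<close> into the
      contraction factor \<open>1 - F {}\<close>.\<close>
    have "F {} * F X \<le> F {}" using F_le_1[of X] F_empty_pos by simp
    then have "F X - F {} \<le> (1 - F {}) * F X" by (simp add: algebra_simps)
    then show ?thesis using c mult_left_mono by fastforce
  qed
  finally show ?case by (simp add: mult.assoc mult.left_commute)
qed

text \<open>For \<open>X = V\<close> the condition is void: every minimal cluster meets
  \<open>V\<close>, so \<open>F V = 1\<close> and \<open>Q V = 0\<close>.\<close>

lemma E_iterate_pop_step_le:
  assumes "0 \<le> b"
  shows "E ((pop_step ^^ N) (\<lambda>_. b)) \<le> K + (b + card A / F {}) * (1 - F {}) ^ N"
proof -
  have off: "mcs_off V S = {}" for S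
    using mcs_subset[of S] by (auto simp: mcs_off_def)
  have "F V = 1" "Q V = 0"
    by (simp_all add: F_def Q_def off solo_def is_singleton_def E_const)
  then show ?thesis using E_iterate_pop_step[OF assms, of V N] by (simp add: off)
qed

end

section \<open>The ratio of unique-cluster weight to root-connected weight\<close>

context weighted_rooted_graph
begin

lemma arc_weight_reverse_in:
  assumes "\<And>u v. (u, v) \<in> A \<Longrightarrow> p (u, v) = p (v, u)"
  shows "arc_weight p A (reverse_in U -` S) = arc_weight p A S"
proof -
  have bij: "bij_betw (reverse_in U) A A"
    by (rule bij_betw_byWitness[where f' = "reverse_in U"]) (auto simp: reverse_in_arcs)
  have p: "p (reverse_in U a) = p a" if "a \<in> A" for a
    using assms[of "fst a" "snd a"] that by (auto simp: reverse_in_def prod.swap_def)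
  have "arc_weight p A S
      = (\<Prod>a\<in>A. if reverse_in U a \<in> S then 1 - p (reverse_in U a) else p (reverse_in U a))"
    unfolding arc_weight_def by (rule prod.reindex_bij_betw[OF bij, symmetric])
  also have "\<dots> = arc_weight p A (reverse_in U -` S)"
    unfolding arc_weight_def using p by (intro prod.cong) auto
  finally show ?thesis ..
qed

lemma arc_weight_insert:
  assumes "e \<in> A" "e \<notin> T"
  shows "p e * arc_weight p A (insert e T) = (1 - p e) * arc_weight p A T"
proof -
  have "arc_weight p A T = p e * (\<Prod>a\<in>A - {e}. if a \<in> T then 1 - p a else p a)"
    unfolding arc_weight_def using assms finite_arcs by (subst prod.remove[of A e]) auto
  moreover have "(\<Prod>a\<in>A - {e}. if a \<in> insert e T then 1 - p a else p a)
      = (\<Prod>a\<in>A - {e}. if a \<in> T then 1 - p a else p a)"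
    by (intro prod.cong) auto
  then have "arc_weight p A (insert e T)
      = (1 - p e) * (\<Prod>a\<in>A - {e}. if a \<in> T then 1 - p a else p a)"
    unfolding arc_weight_def using assms finite_arcs by (subst prod.remove[of A e]) auto
  ultimately show ?thesis by simp
qed

context
  fixes \<rho> :: real
  assumes p_sym: "\<And>u v. (u, v) \<in> A \<Longrightarrow> p (u, v) = p (v, u)"
    and odds_le: "\<And>a. a \<in> A \<Longrightarrow> p a / (1 - p a) \<le> \<rho>"
begin

text \<open>Reversal keeps the weight, and adding the boundary arc \<open>e\<close> exchanges a
  factor \<open>p e\<close> for \<open>1 - p e\<close>. So the quotient of the weights is the odds
  \<open>p e / (1 - p e)\<close>.\<close>

lemma arc_weight_repair:
  assumes S: "S \<subseteq> A" "mcs S = {C}" "u \<in> C"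
  shows "arc_weight p A S \<le> \<rho> * arc_weight p A (repair S)"
proof -
  let ?e = "boundary_arc S"
  let ?T = "repair S - {?e}"
  have e: "?e \<in> A" by (rule boundary_arc[OF S])
  have ins: "insert ?e ?T = repair S" by (auto simp: repair_def)
  have "arc_weight p A ?T = arc_weight p A S"
    unfolding repair_diff[OF S] by (rule arc_weight_reverse_in) (rule p_sym)
  then have "p ?e * arc_weight p A (repair S) = (1 - p ?e) * arc_weight p A S"
    using arc_weight_insert[OF e, of ?T] unfolding ins by simp
  then have "arc_weight p A S = p ?e / (1 - p ?e) * arc_weight p A (repair S)"
    using p_range[OF e] by (simp add: field_simps)
  also have "\<dots> \<le> \<rho> * arc_weight p A (repair S)"
    using odds_le[OF e] arc_weight_pos[of "repair S"] by (intro mult_right_mono) auto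
  finally show ?thesis .
qed

text \<open>The injection sends these subgraphs to pairs of a root-connected subgraph and one of its
  at most \<open>card V\<close> bridges, losing a factor of at most \<open>\<rho>\<close> in
  weight.\<close>

lemma unique_mc_weight_le:
  assumes "A \<noteq> {}"
  shows "(\<Sum>S | S \<subseteq> A \<and> (\<exists>C. mcs S = {C} \<and> u \<in> C). arc_weight p A S) \<le> \<rho> * card V * F {}"
proof -
  let ?U = "{S. S \<subseteq> A \<and> (\<exists>C. mcs S = {C} \<and> u \<in> C)}"
  let ?c = "{T. T \<subseteq> A \<and> mcs T = {}}"
  let ?f = "\<lambda>S. (repair S, boundary_arc S)"
  have fin: "finite ?c" by (rule finite_subset[of _ "Pow A"]) (use finite_arcs in auto)
  have finb: "finite (bridges u r T)" if "T \<subseteq> A" for T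
    using that finite_arcs by (auto simp: bridges_def intro: finite_subset)
  obtain a where a: "a \<in> A" using assms by blast
  have \<rho>: "0 \<le> \<rho>"
    using odds_le[OF a] p_range[OF a] divide_nonneg_nonneg[of "p a" "1 - p a"] by linarith
  have "(\<Sum>S\<in>?U. arc_weight p A S) \<le> (\<Sum>S\<in>?U. \<rho> * arc_weight p A (repair S))"
    using arc_weight_repair by (intro sum_mono) auto
  also have "\<dots> = \<rho> * (\<Sum>S\<in>?U. arc_weight p A (fst (?f S)))"
    by (simp add: sum_distrib_left)
  also have "(\<Sum>S\<in>?U. arc_weight p A (fst (?f S))) = (\<Sum>x\<in>?f ` ?U. arc_weight p A (fst x))"
    using sum.reindex[OF inj_on_repair, of "\<lambda>x. arc_weight p A (fst x)" u] by simp
  also have "\<dots> \<le> (\<Sum>x\<in>(SIGMA T:?c. bridges u r T). arc_weight p A (fst x))"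
  proof (rule sum_mono2)
    show "finite (SIGMA T:?c. bridges u r T)"
      by (rule finite_SigmaI[OF fin finb]) simp
    show "?f ` ?U \<subseteq> (SIGMA T:?c. bridges u r T)"
    proof (rule image_subsetI)
      fix S assume "S \<in> ?U"
      then obtain C where S: "S \<subseteq> A" "mcs S = {C}" "u \<in> C" by blast
      then show "?f S \<in> (SIGMA T:?c. bridges u r T)"
        using repair_subset[OF S] repair_connected[OF S] boundary_arc_bridge[OF S] by simp
    qed
  qed (simp add: arc_weight_pos less_imp_le)
  also have "\<dots> = (\<Sum>T\<in>?c. \<Sum>e\<in>bridges u r T. arc_weight p A T)"
    using fin finb by (subst sum.Sigma) (simp_all add: case_prod_beta)
  also have "\<dots> \<le> (\<Sum>T\<in>?c. card V * arc_weight p A T)"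
  proof (intro sum_mono)
    fix T assume "T \<in> ?c"
    then have "card (bridges u r T) \<le> card V"
      using finite_verts arcs_subset by (intro card_bridges_le) auto
    then show "(\<Sum>e\<in>bridges u r T. arc_weight p A T) \<le> card V * arc_weight p A T"
      using arc_weight_pos[of T] by simp
  qed
  also have "\<dots> = card V * F {}"
  proof -
    have "F {} = (\<Sum>T\<in>Pow A. if mcs T = {} then arc_weight p A T else 0)"
      unfolding F_def arc_sum_def mcs_off_def by (intro sum.cong) auto
    also have "\<dots> = (\<Sum>T\<in>?c. arc_weight p A T)"
      using finite_arcs by (simp add: sum.inter_filter[symmetric] Pow_def)
    finally show ?thesis by (simp add: sum_distrib_left)
  qed
  finally show ?thesis using \<rho> mult_left_mono by fastforce
qed

text \<open>The arcs leaving vertices of the unique minimal cluster are grouped by their tail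
  \<open>u\<close>.\<close>

lemma Q_empty_eq:
  "Q {} = (\<Sum>u\<in>V. card (out_arcs {u})
    * (\<Sum>S | S \<subseteq> A \<and> (\<exists>C. mcs S = {C} \<and> u \<in> C). arc_weight p A S))"
proof -
  let ?P = "\<lambda>S u. \<exists>C. mcs S = {C} \<and> u \<in> C"
  have *: "solo (mcs S) = (\<Sum>u\<in>V. if ?P S u then real (card (out_arcs {u})) else 0)" for S
  proof (cases "is_singleton (mcs S)")
    case False
    then show ?thesis by (auto simp: solo_def is_singleton_def intro!: sum.neutral[symmetric])
  next
    case True
    then obtain C where C: "mcs S = {C}" by (auto simp: is_singleton_def)
    then have "C \<subseteq> V" using mcs_subset by blast
    then have "finite C" using finite_verts finite_subset by blast
    have "out_arcs C = (\<Union>u\<in>C. out_arcs {u})" by (auto simp: out_arcs_def)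
    also have "card \<dots> = (\<Sum>u\<in>C. card (out_arcs {u}))"
      using \<open>finite C\<close> by (intro card_UN_disjoint) (simp, simp, auto simp: out_arcs_def)
    finally have "solo (mcs S) = (\<Sum>u\<in>C. real (card (out_arcs {u})))" by (simp add: solo_def C)
    also have "\<dots> = (\<Sum>u\<in>V. if u \<in> C then real (card (out_arcs {u})) else 0)"
      using finite_verts \<open>C \<subseteq> V\<close> by (simp add: sum.If_cases Int_absorb1)
    finally show ?thesis by (simp add: C)
  qed
  have "Q {} = (\<Sum>S\<in>Pow A. \<Sum>u\<in>V. card (out_arcs {u}) * (if ?P S u then arc_weight p A S else 0))"
    unfolding Q_def arc_sum_def mcs_off_def using *
    by (simp add: sum_distrib_left if_distrib mult.commute cong: if_cong)
  also have "\<dots> = (\<Sum>u\<in>V. card (out_arcs {u}) * (\<Sum>S\<in>Pow A. if ?P S u then arc_weight p A S else 0))"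
    by (subst sum.swap) (simp add: sum_distrib_left)
  finally show ?thesis
    using finite_arcs by (simp add: sum.inter_filter[symmetric] Pow_def)
qed

text \<open>The bound for each \<open>u\<close> is independent of \<open>u\<close>, and the
  out-degrees sum to \<open>card A\<close>.\<close>

lemma K_le: "K \<le> \<rho> * card A * card V"
proof (cases "A = {}")
  case True
  then show ?thesis using Q_bounds[of "{}"] by (simp add: K_def)
next
  case False
  have "A = (\<Union>u\<in>V. out_arcs {u})" using arcs_subset by (auto simp: out_arcs_def)
  also have "card \<dots> = (\<Sum>u\<in>V. card (out_arcs {u}))"
    using finite_verts by (intro card_UN_disjoint) (simp, simp, auto simp: out_arcs_def)
  finally have A: "real (card A) = (\<Sum>u\<in>V. real (card (out_arcs {u})))" by simp
  have "Q {} \<le> (\<Sum>u\<in>V. card (out_arcs {u}) * (\<rho> * card V * F {}))"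
    unfolding Q_empty_eq using unique_mc_weight_le[OF False]
    by (intro sum_mono mult_left_mono) auto
  also have "\<dots> = \<rho> * card A * card V * F {}"
    unfolding A by (simp add: sum_distrib_right sum_distrib_left mult_ac)
  finally show ?thesis using F_empty_pos by (simp add: K_def field_simps)
qed

end

end

section \<open>Expected number of draws\<close>

definition draws :: "(('a \<times> 'a) set \<times> nat) option \<Rightarrow> ennreal" where
  "draws x = (case x of None \<Rightarrow> \<infinity> | Some (S, k) \<Rightarrow> of_nat k)"

text \<open>Truncation keeps the cost of nonterminating runs finite; letting \<open>b\<close> grow
  recovers their infinite cost.\<close>

lemma SUP_min_draws: "(SUP b. min (draws x) (of_nat b)) = draws x"
proof (rule antisym)
  show "(SUP b. min (draws x) (of_nat b)) \<le> draws x" by (intro SUP_least) simp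
  show "draws x \<le> (SUP b. min (draws x) (of_nat b))"
  proof (cases x)
    case None
    then show ?thesis by (simp add: draws_def ennreal_SUP_of_nat_eq_top)
  next
    case (Some y)
    then have "draws x = min (draws x) (of_nat (snd y))" by (simp add: draws_def case_prod_beta)
    also have "\<dots> \<le> (SUP b. min (draws x) (of_nat b))" by (rule SUP_upper) simp
    finally show ?thesis .
  qed
qed

context weighted_rooted_graph
begin

lemma iterate_pop_step_nonneg:
  assumes "0 \<le> b"
  shows "0 \<le> (pop_step ^^ N) (\<lambda>_. b) S"
proof (induction N arbitrary: S)
  case (Suc N)
  have "0 \<le> arc_sum p (out_arcs U) (\<lambda>R. (pop_step ^^ N) (\<lambda>_. b) (S - out_arcs U \<union> R))" for U
    unfolding arc_sum_def using Suc arc_weight_nonneg[of "out_arcs U" p] p_range_sub[OF out_arcs_subset]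
    by (intro sum_nonneg mult_nonneg_nonneg) auto
  then show ?case by (simp add: pop_step_def[of "(pop_step ^^ N) (\<lambda>_. b)" S] Let_def)
qed (simp add: assms)

text \<open>Runs longer than \<open>N\<close> rounds are charged the truncation level \<open>b\<close>; this needs only the
  unfolding equation of \<open>popping_loop\<close>.\<close>

lemma popping_loop_draws_le:
  assumes "S \<subseteq> A"
  shows "(\<integral>\<^sup>+ x. min (draws x) (of_nat b) \<partial>measure_pmf (popping_loop G r p S k))
    \<le> ennreal (k + (pop_step ^^ N) (\<lambda>_. real b) S)"
  using assms
proof (induction N arbitrary: S k)
  case 0
  have "(\<integral>\<^sup>+ x. min (draws x) (of_nat b) \<partial>measure_pmf (popping_loop G r p S k))
      \<le> (\<integral>\<^sup>+ x. of_nat b \<partial>measure_pmf (popping_loop G r p S k))"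
    by (intro nn_integral_mono) simp
  also have "\<dots> = ennreal (real b)" by (simp add: ennreal_of_nat_eq_real_of_nat)
  also have "\<dots> \<le> ennreal (real k + real b)" by (intro ennreal_leI) simp
  finally show ?case by simp
next
  case (Suc N)
  let ?Z = "(pop_step ^^ N) (\<lambda>_. real b)"
  show ?case
  proof (cases "mcs S = {}")
    case True
    then have "popping_loop G r p S k = return_spmf (S, k)"
      by (subst popping_loop.simps) (auto simp: mcs_empty_iff)
    then show ?thesis
      using True by (simp add: draws_def pop_step_def ennreal_of_nat_eq_real_of_nat min.coboundedI1)
  next
    case False
    let ?B = "out_arcs (\<Union>(mcs S))"
    have "popping_loop G r p S k = bind_pmf (random_arcs p ?B)
        (\<lambda>R. popping_loop G r p (S - ?B \<union> R) (k + card ?B))"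
      using False by (subst popping_loop.simps) (simp add: mcs_empty_iff popped_arcs_eq bind_spmf_of_pmf)
    then have "(\<integral>\<^sup>+ x. min (draws x) (of_nat b) \<partial>measure_pmf (popping_loop G r p S k))
        = (\<integral>\<^sup>+ R. (\<integral>\<^sup>+ x. min (draws x) (of_nat b)
            \<partial>measure_pmf (popping_loop G r p (S - ?B \<union> R) (k + card ?B)))
          \<partial>measure_pmf (random_arcs p ?B))"
      by simp
    also have "\<dots> \<le> (\<integral>\<^sup>+ R. ennreal (real (k + card ?B) + ?Z (S - ?B \<union> R))
        \<partial>measure_pmf (random_arcs p ?B))"
    proof (intro nn_integral_mono_AE, unfold AE_measure_pmf_iff, rule ballI)
      fix R assume "R \<in> set_pmf (random_arcs p ?B)"
      then have "R \<subseteq> ?B" using set_pmf_random_arcs by blast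
      then have "S - ?B \<union> R \<subseteq> A" using Suc.prems out_arcs_subset by blast
      then show "(\<integral>\<^sup>+ x. min (draws x) (of_nat b)
            \<partial>measure_pmf (popping_loop G r p (S - ?B \<union> R) (k + card ?B)))
          \<le> ennreal (real (k + card ?B) + ?Z (S - ?B \<union> R))" by (rule Suc.IH)
    qed
    also have "\<dots> = ennreal (arc_sum p ?B (\<lambda>R. real (k + card ?B) + ?Z (S - ?B \<union> R)))"
    proof (rule nn_integral_random_arcs)
      show "0 \<le> real (k + card ?B) + ?Z (S - ?B \<union> R)" for R
        using iterate_pop_step_nonneg[of "real b" N "S - ?B \<union> R"] by simp
    qed (use p_range_sub[OF out_arcs_subset] in auto)
    also have "arc_sum p ?B (\<lambda>R. real (k + card ?B) + ?Z (S - ?B \<union> R))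
        = k + (pop_step ^^ Suc N) (\<lambda>_. real b) S"
    proof -
      have "arc_sum p ?B (\<lambda>_. real (k + card ?B)) = real (k + card ?B)"
        by (rule arc_sum_const[OF finite_out_arcs]) (rule p_range_sub[OF out_arcs_subset])
      then show ?thesis using False unfolding arc_sum_add by (simp add: pop_step_def Let_def)
    qed
    finally show ?thesis .
  qed
qed

text \<open>For fixed \<open>b\<close>, the error term decays geometrically in the number
  \<open>N\<close> of rounds because \<open>F {}\<close> is positive.\<close>

lemma truncated_draws_le:
  "(\<integral>\<^sup>+ x. min (draws x) (of_nat b) \<partial>measure_pmf (cluster_popping G r p)) \<le> ennreal (card A + K)"
    (is "?I \<le> _")
proof -
  have le: "?I \<le> ennreal (card A + (K + (real b + card A / F {}) * (1 - F {}) ^ N))" for N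
  proof -
    let ?Z = "(pop_step ^^ N) (\<lambda>_. real b)"
    have "?I = (\<integral>\<^sup>+ S. (\<integral>\<^sup>+ x. min (draws x) (of_nat b)
          \<partial>measure_pmf (popping_loop G r p S (card A))) \<partial>measure_pmf (random_arcs p A))"
      by (simp add: cluster_popping_def bind_spmf_of_pmf)
    also have "\<dots> \<le> (\<integral>\<^sup>+ S. ennreal (card A + ?Z S) \<partial>measure_pmf (random_arcs p A))"
    proof (intro nn_integral_mono_AE, unfold AE_measure_pmf_iff, rule ballI)
      fix S assume "S \<in> set_pmf (random_arcs p A)"
      then have "S \<subseteq> A" using set_pmf_random_arcs by blast
      then show "(\<integral>\<^sup>+ x. min (draws x) (of_nat b) \<partial>measure_pmf (popping_loop G r p S (card A)))
          \<le> ennreal (card A + ?Z S)" by (rule popping_loop_draws_le)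
    qed
    also have "\<dots> = ennreal (E (\<lambda>S. card A + ?Z S))"
    proof (rule nn_integral_random_arcs[OF finite_arcs])
      show "0 \<le> card A + ?Z S" for S
        using iterate_pop_step_nonneg[of "real b" N S] by simp
    qed (rule p_range)
    also have "\<dots> \<le> ennreal (card A + (K + (real b + card A / F {}) * (1 - F {}) ^ N))"
      using E_iterate_pop_step_le[of "real b" N] unfolding arc_sum_add E_const
      by (intro ennreal_leI) simp
    finally show ?thesis .
  qed
  have "(\<lambda>N. (1 - F {}) ^ N) \<longlonglongrightarrow> 0"
    using F_empty_pos F_le_1[of "{}"] by (intro LIMSEQ_realpow_zero) auto
  then have "(\<lambda>N. card A + (K + (real b + card A / F {}) * (1 - F {}) ^ N))
      \<longlonglongrightarrow> card A + (K + (real b + card A / F {}) * 0)"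
    by (intro tendsto_add tendsto_mult tendsto_const)
  then have "(\<lambda>N. ennreal (card A + (K + (real b + card A / F {}) * (1 - F {}) ^ N)))
      \<longlonglongrightarrow> ennreal (card A + K)"
    using tendsto_ennrealI by fastforce
  then show ?thesis by (rule LIMSEQ_le_const) (use le in blast)
qed

text \<open>The truncated bound does not depend on \<open>b\<close>, so monotone convergence removes
  the truncation. In particular almost every run terminates.\<close>

lemma expected_draws_le: "expected_draws G r p \<le> ennreal (card A + K)"
proof -
  have "expected_draws G r p
      = (\<integral>\<^sup>+ x. (SUP b. min (draws x) (of_nat b)) \<partial>measure_pmf (cluster_popping G r p))"
    unfolding expected_draws_def SUP_min_draws unfolding draws_def ..
  also have "\<dots> = (SUP b. \<integral>\<^sup>+ x. min (draws x) (of_nat b) \<partial>measure_pmf (cluster_popping G r p))"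
    by (intro nn_integral_monotone_convergence_SUP)
      (auto intro!: incseq_SucI le_funI min.mono)
  also have "\<dots> \<le> ennreal (card A + K)"
    by (intro SUP_least truncated_draws_le)
  finally show ?thesis .
qed

end

section \<open>The bound for connected bi-directed graphs\<close>

text \<open>The arc set is its own symmetric closure, so connectedness already gives directed walks
  to \<open>r\<close>.\<close>

lemma rooted_graphI:
  assumes "pair_pseudo_graph G" "Digraph_Component.connected (with_proj G)" "r \<in> pverts G"
  shows "rooted_graph G r"
proof -
  interpret pair_pseudo_graph G by fact
  have sym: "(v, u) \<in> parcs G" if "(u, v) \<in> parcs G" for u v
    using pair_sym_arcs that by (auto simp: symmetric_def dest: symD)
  have mk: "parcs (mk_symmetric (with_proj G)) = parcs G"
    using sym by (auto simp: parcs_mk_symmetric)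
  show ?thesis
  proof
    show "(v, r) \<in> (parcs G)\<^sup>*" if "v \<in> pverts G" for v
      using assms(2,3) that
      by (auto simp: connected_def strongly_connected_def reachable_def mk
          intro: rtrancl_on_rtranclI)
  qed (use pair_finite_verts assms(3) sym in \<open>auto dest: in_arcsD1 in_arcsD2\<close>)
qed

theorem theorem3p3:
  fixes G :: "'a pair_pre_digraph" and r :: 'a and p :: "'a \<times> 'a \<Rightarrow> real"
    and n m :: nat and p_max :: real
  assumes bidirected: "pair_pseudo_graph G"
    and conn: "Digraph_Component.connected (with_proj G)"
    and root: "r \<in> pverts G"
    and n: "n = card (pverts G)" and m: "m = card (parcs G)"
    and p_range: "\<And>a. a \<in> parcs G \<Longrightarrow> 0 < p a \<and> p a < 1"
    and p_sym: "\<And>u v. (u, v) \<in> parcs G \<Longrightarrow> p (u, v) = p (v, u)"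
    and p_max: "p_max = Max (p ` parcs G)"
  shows "expected_draws G r p \<le>
           ennreal (real m + p_max * real m * real n / (1 - p_max))"
proof -
  interpret rooted_graph G r using bidirected conn root by (rule rooted_graphI)
  interpret weighted_rooted_graph G r p by unfold_locales (rule p_range)
  \<comment> \<open>The maximum is attained at some arc, hence is below 1, and
    \<open>x / (1 - x)\<close> increases there.\<close>
  have odds: "p a / (1 - p a) \<le> p_max / (1 - p_max)" if a: "a \<in> parcs G" for a
  proof -
    have "p_max \<in> p ` parcs G" unfolding p_max using finite_arcs a by (intro Max_in) auto
    then have "p_max < 1" using p_range by auto
    moreover have "p a \<le> p_max" unfolding p_max using finite_arcs a by (intro Max_ge) auto
    ultimately show ?thesis using p_range[OF a] by (intro frac_le) auto
  qed
  have "K \<le> p_max / (1 - p_max) * card (parcs G) * card (pverts G)"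
    using p_sym odds by (rule K_le)
  then have "real m + K \<le> real m + p_max * real m * real n / (1 - p_max)"
    by (simp add: n m)
  then show ?thesis
    using expected_draws_le unfolding m[symmetric] by (meson ennreal_leI order_trans)
qed

end
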